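(* Let $k,r$ be positive integers and $h=4$, such that $\ell=\frac{k+4}{r}$ is an integer. Let $m$ be the smallest integer such that $3\mid(m-1)$ and $\ell\le 2^{r(m-1)}$. Then there exists a maximally recoverable local $(k,r,4)$-code over the field $\mathbb{F}_{2^t}$, where $t=r\left(2m+\frac{m-1}{3}\right)$.
   Context: For positive integers $k,r,h$ with $r\mid(k+h)$, a local $(k,r,h)$-code over a finite field $\mathbb{F}$ is a linear systematic code of dimension $k$ and length $k+h+\frac{k+h}{r}$ consisting of $k$ data symbols, $h$ heavy parity symbols (each a fixed $\mathbb{F}$-linear combination of all data symbols), and, after partitioning the $k+h$ data and heavy parity symbols into $\frac{k+h}{r}$ groups of size $r$, one local parity per group equal to the sum (XOR) of the group's symbols. A local group is such a group together with its local parity. The code is maximally recoverable if for every set $E$ of coordinates containing exactly one coordinate from each local group, puncturing the code in $E$ yields a maximum distance separable $[k+h,k]$ code (minimum distance $h+1$). *)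

theory Defs
  imports Main
begin

(* Coordinates of a local (k,r,h)-code of length n = k+h+(k+h)/r:
   0..k-1 data symbols, k..k+h-1 heavy parities, k+h..k+h+l-1 local parities
   (l = (k+h) div r).  Vectors are functions nat => 'a (zero outside the range).
   H :: nat => nat => 'a gives the heavy parity coefficients: parity j = sum_i H j i * x i.
   g :: nat => nat assigns each of the k+h data/heavy symbols to its local group. *)

definition sys_part :: "nat \<Rightarrow> nat \<Rightarrow> (nat \<Rightarrow> nat \<Rightarrow> 'a::field) \<Rightarrow> (nat \<Rightarrow> 'a) \<Rightarrow> nat \<Rightarrow> 'a" where
  "sys_part k h H x i =
     (if i < k then x i
      else if i < k + h then (\<Sum>j<k. H (i - k) j * x j)
      else 0)"

definition local_encode ::
  "nat \<Rightarrow> nat \<Rightarrow> nat \<Rightarrow> (nat \<Rightarrow> nat \<Rightarrow> 'a::field) \<Rightarrow> (nat \<Rightarrow> nat) \<Rightarrow> (nat \<Rightarrow> 'a) \<Rightarrow> nat \<Rightarrow> 'a" where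
  "local_encode k r h H g x =
     (\<lambda>i. if i < k + h then sys_part k h H x i
          else if i < k + h + (k + h) div r then
            (\<Sum>i'\<in>{i'. i' < k + h \<and> g i' = i - (k + h)}. sys_part k h H x i')
          else 0)"

definition data_vectors :: "nat \<Rightarrow> (nat \<Rightarrow> 'a::zero) set" where
  "data_vectors k = {x. \<forall>i\<ge>k. x i = 0}"

definition local_code ::
  "nat \<Rightarrow> nat \<Rightarrow> nat \<Rightarrow> (nat \<Rightarrow> nat \<Rightarrow> 'a::field) \<Rightarrow> (nat \<Rightarrow> nat) \<Rightarrow> (nat \<Rightarrow> 'a) set" where
  "local_code k r h H g = local_encode k r h H g ` data_vectors k"

definition code_length :: "nat \<Rightarrow> nat \<Rightarrow> nat \<Rightarrow> nat" where
  "code_length k r h = k + h + (k + h) div r"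

definition valid_grouping :: "nat \<Rightarrow> nat \<Rightarrow> nat \<Rightarrow> (nat \<Rightarrow> nat) \<Rightarrow> bool" where
  "valid_grouping k r h g \<longleftrightarrow>
     (\<forall>i<k + h. g i < (k + h) div r) \<and>
     (\<forall>j<(k + h) div r. card {i. i < k + h \<and> g i = j} = r)"

definition local_group :: "nat \<Rightarrow> nat \<Rightarrow> (nat \<Rightarrow> nat) \<Rightarrow> nat \<Rightarrow> nat set" where
  "local_group k h g j = {i. i < k + h \<and> g i = j} \<union> {k + h + j}"

definition restrict_coords :: "nat set \<Rightarrow> (nat \<Rightarrow> 'a::zero) set \<Rightarrow> (nat \<Rightarrow> 'a) set" where
  "restrict_coords S C = (\<lambda>c. \<lambda>i. if i \<in> S then c i else 0) ` C"

definition hamming_weight :: "nat set \<Rightarrow> (nat \<Rightarrow> 'a::zero) \<Rightarrow> nat" where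
  "hamming_weight S c = card {i \<in> S. c i \<noteq> 0}"

definition min_distance :: "nat set \<Rightarrow> (nat \<Rightarrow> 'a::zero) set \<Rightarrow> nat" where
  "min_distance S C = Min {hamming_weight S c | c. c \<in> C \<and> c \<noteq> (\<lambda>_. 0)}"

(* C, a linear code with coordinate set S (|S| = n), is an MDS [n,kk] code:
   dimension kk (i.e. q^kk codewords) and minimum distance n - kk + 1 *)
definition is_mds_code :: "nat set \<Rightarrow> nat \<Rightarrow> (nat \<Rightarrow> 'a::{finite,field}) set \<Rightarrow> bool" where
  "is_mds_code S kk C \<longleftrightarrow>
     card C = card (UNIV :: 'a set) ^ kk \<and> min_distance S C = card S - kk + 1"

definition maximally_recoverable ::
  "nat \<Rightarrow> nat \<Rightarrow> nat \<Rightarrow> (nat \<Rightarrow> nat \<Rightarrow> 'a::{finite,field}) \<Rightarrow> (nat \<Rightarrow> nat) \<Rightarrow> bool" where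
  "maximally_recoverable k r h H g \<longleftrightarrow>
     (\<forall>E. E \<subseteq> {..<code_length k r h} \<and>
          (\<forall>j<(k + h) div r. card (E \<inter> local_group k h g j) = 1) \<longrightarrow>
          is_mds_code ({..<code_length k r h} - E) k
            (restrict_coords ({..<code_length k r h} - E) (local_code k r h H g)))"

end

theory Submission
  imports Defs "HOL-Algebra.Algebraic_Closure_Type" "HOL-Library.Product_Plus" "HOL-Library.FuncSet"
begin

text \<open>Attach a point \<open>\<alpha> i\<close> of the field to every coordinate, \<open>0\<close> to the local parities, and impose the heavy
  checks \<open>\<Sum>i. \<alpha> i ^ (2 ^ e) * c i = 0\<close> for \<open>e < 4\<close>. A square Moore matrix is invertible iff its generators
  are independent over the field with two elements, so maximal recoverability reduces to binary
  independence of any four differences of points inside the local groups.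

  Write \<open>q = 2 ^ r\<close> and \<open>m = 3 * s + 1\<close>, and let \<open>\<sigma>\<close> be the Frobenius map of order 3 of the field with
  \<open>q ^ (3 * s)\<close> elements over the one with \<open>q ^ s\<close> elements. Distinct elements \<open>x\<close> of the big field are assigned
  to the groups; any four of the vectors \<open>(1, x, x * \<sigma> x, x * \<sigma> x * \<sigma> (\<sigma> x))\<close> are independent over the field
  with \<open>q\<close> elements. The points of a group are the multiples of its vector by a binary basis of the field
  with \<open>q\<close> elements. These vectors live in a binary space of dimension \<open>r * (1 + 7 * s) \<le> t\<close>, which embeds
  additively into the field with \<open>2 ^ t\<close> elements.\<close>

section \<open>Elementary abelian 2-groups\<close>

text \<open>Elements of \<open>I \<inter> J\<close> contribute twice and cancel. Under symmetric
  difference, finite index sets thus behave like coordinate vectors over the field with two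
  elements, and \<open>sum f\<close> is linear on them.\<close>

lemma sum_sym_diff_char2:
  fixes f :: "'i \<Rightarrow> 'b::ab_group_add"
  assumes "\<And>x::'b. x + x = 0" "finite I" "finite J"
  shows "sum f (sym_diff I J) = sum f I + sum f J"
proof -
  have "sum f I = sum f (I - J) + sum f (I \<inter> J)"
    using assms(2) by (metis sum.Int_Diff add.commute)
  moreover have "sum f J = sum f (J - I) + sum f (I \<inter> J)"
    using assms(3) by (metis sum.Int_Diff add.commute Int_commute)
  moreover have "sum f (sym_diff I J) = sum f (I - J) + sum f (J - I)"
    using assms by (intro sum.union_disjoint) auto
  ultimately have "sum f I + sum f J = sum f (sym_diff I J) + (sum f (I \<inter> J) + sum f (I \<inter> J))"
    by (simp add: algebra_simps)
  then show ?thesis using assms(1) by simp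
qed

text \<open>Greedy choice: the \<open>n\<close> elements chosen so far have at most
  \<open>2 ^ n\<close> subset sums, fewer than \<open>card V\<close>, so some element of
  \<open>V\<close> lies outside them and extends the family.\<close>

lemma ex_binary_independent:
  fixes V :: "'b::ab_group_add set"
  assumes char2: "\<And>x::'b. x + x = 0" and "finite V" "2 ^ n \<le> card V"
  shows "\<exists>b::nat \<Rightarrow> 'b. b ` {..<n} \<subseteq> V \<and> (\<forall>I\<subseteq>{..<n}. I \<noteq> {} \<longrightarrow> sum b I \<noteq> 0)"
  using assms(3)
proof (induction n)
  case 0
  then show ?case by auto
next
  case (Suc n)
  then obtain b where b: "b ` {..<n} \<subseteq> V" "\<And>I. I \<subseteq> {..<n} \<Longrightarrow> I \<noteq> {} \<Longrightarrow> sum b I \<noteq> 0"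
    by (auto simp: image_subset_iff)
  have "card (sum b ` Pow {..<n}) \<le> 2 ^ n"
    using card_image_le[of "Pow {..<n}" "sum b"] by (simp add: card_Pow)
  also have "\<dots> < card V" using Suc.prems by (simp add: less_le_trans[of _ "2 * 2 ^ n"])
  finally have "\<not> V \<subseteq> sum b ` Pow {..<n}"
    using card_mono[of "sum b ` Pow {..<n}" V] by auto
  then obtain v where v: "v \<in> V" "v \<notin> sum b ` Pow {..<n}" by auto
  define b' where "b' = b(n := v)"
  have b'_sum: "sum b' I = sum b I" if "I \<subseteq> {..<n}" for I
    using that by (intro sum.cong) (auto simp: b'_def)
  have "sum b' I \<noteq> 0" if I: "I \<subseteq> {..<Suc n}" "I \<noteq> {}" for I
  proof (cases "n \<in> I")
    case True
    have sub: "I - {n} \<subseteq> {..<n}" using I by (auto simp: less_Suc_eq)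
    have "finite I" using I finite_subset by blast
    then have "sum b' I = v + sum b (I - {n})"
      using True b'_sum[OF sub] by (simp add: sum.remove[of I n] b'_def)
    moreover have "v \<noteq> sum b (I - {n})" using v sub by auto
    ultimately show ?thesis
      using char2 by (metis add_right_imp_eq)
  next
    case False
    then have "I \<subseteq> {..<n}" using I by (auto simp: less_Suc_eq subset_iff)
    then show ?thesis using b(2)[of I] b'_sum I by simp
  qed
  moreover have "b' ` {..<Suc n} \<subseteq> V"
    using b(1) v(1) by (auto simp: b'_def less_Suc_eq)
  ultimately show ?case by blast
qed

lemma inj_on_sum_binary_independent:
  fixes b :: "nat \<Rightarrow> 'b::ab_group_add"
  assumes char2: "\<And>x::'b. x + x = 0"
    and indep: "\<And>I. I \<subseteq> {..<n} \<Longrightarrow> I \<noteq> {} \<Longrightarrow> sum b I \<noteq> 0"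
  shows "inj_on (sum b) (Pow {..<n})"
proof (rule inj_onI)
  fix I J assume IJ: "I \<in> Pow {..<n}" "J \<in> Pow {..<n}" "sum b I = sum b J"
  then have "finite I" "finite J" by (auto intro: finite_subset)
  then have "sum b (sym_diff I J) = 0"
    using sum_sym_diff_char2[OF char2] IJ char2 by metis
  then have "sym_diff I J = {}" using indep[of "sym_diff I J"] IJ by auto
  then show "I = J" by auto
qed

text \<open>By counting, the subset sums of an independent family of length \<open>n\<close> exhaust
  \<open>V\<close>, so the family is a basis. The map reads off the index set of an element and
  takes the corresponding subset sum of an independent family in the target.\<close>

lemma ex_additive_embedding:
  fixes V :: "'b::ab_group_add set"
  assumes char2b: "\<And>x::'b. x + x = 0" and char2a: "\<And>x::'a::ab_group_add. x + x = 0"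
    and V: "finite V" "\<And>x y. x \<in> V \<Longrightarrow> y \<in> V \<Longrightarrow> x + y \<in> V" "0 \<in> V" "card V = 2 ^ n"
    and a: "finite (UNIV :: 'a set)" "2 ^ n \<le> card (UNIV :: 'a set)"
  shows "\<exists>\<phi> :: 'b \<Rightarrow> 'a. (\<forall>x\<in>V. \<forall>y\<in>V. \<phi> (x + y) = \<phi> x + \<phi> y) \<and> (\<forall>x\<in>V. \<phi> x = 0 \<longrightarrow> x = 0)"
proof -
  obtain b where b: "b ` {..<n} \<subseteq> V" "\<And>I. I \<subseteq> {..<n} \<Longrightarrow> I \<noteq> {} \<Longrightarrow> sum b I \<noteq> 0"
    using ex_binary_independent[OF char2b V(1), of n] V(4) by auto
  obtain c :: "nat \<Rightarrow> 'a" where c: "\<And>I. I \<subseteq> {..<n} \<Longrightarrow> I \<noteq> {} \<Longrightarrow> sum c I \<noteq> 0"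
    using ex_binary_independent[OF char2a a] by auto
  have inj: "inj_on (sum b) (Pow {..<n})"
    by (rule inj_on_sum_binary_independent[OF char2b b(2)])
  have "sum b I \<in> V" if "I \<subseteq> {..<n}" for I
  proof -
    have "finite I" using that finite_subset by blast
    then show ?thesis using that b(1)
      by (induction I) (auto intro!: V(2,3))
  qed
  then have "sum b ` Pow {..<n} \<subseteq> V" by auto
  then have surj: "sum b ` Pow {..<n} = V"
    using V(1,4) card_image[OF inj] by (intro card_subset_eq) (auto simp: card_Pow)
  define \<iota> where "\<iota> = inv_into (Pow {..<n}) (sum b)"
  have \<iota>: "\<iota> x \<subseteq> {..<n}" "sum b (\<iota> x) = x" if "x \<in> V" for x
    using that surj inv_into_into[of x "sum b" "Pow {..<n}"] f_inv_into_f[of x "sum b" "Pow {..<n}"]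
    unfolding \<iota>_def by auto
  have fin: "finite (\<iota> x)" if "x \<in> V" for x using \<iota>(1)[OF that] finite_subset by blast
  have "\<iota> (x + y) = sym_diff (\<iota> x) (\<iota> y)" if "x \<in> V" "y \<in> V" for x y
  proof -
    have "sum b (sym_diff (\<iota> x) (\<iota> y)) = x + y"
      using sum_sym_diff_char2[OF char2b fin[OF that(1)] fin[OF that(2)]] \<iota> that by metis
    then show ?thesis
      unfolding \<iota>_def[symmetric] using \<iota>[of x] \<iota>[of y] \<iota>[of "x + y"] V(2) that
      by (intro inj_onD[OF inj]) auto
  qed
  then have "sum c (\<iota> (x + y)) = sum c (\<iota> x) + sum c (\<iota> y)" if "x \<in> V" "y \<in> V" for x y
    using sum_sym_diff_char2[OF char2a fin[OF that(1)] fin[OF that(2)]] that by metis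
  moreover have "x = 0" if "x \<in> V" "sum c (\<iota> x) = 0" for x
    using c[of "\<iota> x"] \<iota>[of x] that by (metis sum.empty)
  ultimately show ?thesis by (intro exI[of _ "\<lambda>x. sum c (\<iota> x)"]) auto
qed

section \<open>Finite subfields of an algebraically closed field\<close>

text \<open>The fixed points are the roots of X^q - X for \<open>q = CHAR('c) ^ n\<close>. This
  polynomial splits, and its derivative is -1, so all \<open>q\<close> roots are simple.\<close>

lemma card_frobenius_fixed:
  assumes "prime CHAR('c::alg_closed_field)" "0 < n"
  shows "card {x::'c. x ^ (CHAR('c) ^ n) = x} = CHAR('c) ^ n"
proof -
  define q where "q = CHAR('c) ^ n"
  have q: "1 < q" unfolding q_def using assms by (intro one_less_power prime_gt_1_nat)
  define p :: "'c poly" where "p = monom 1 q - monom 1 1"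
  have "of_nat q = (0::'c)" using assms by (simp add: q_def)
  then have deriv: "pderiv p = -1"
    by (simp add: p_def pderiv_diff pderiv_monom)
  have deg: "degree p = q"
    unfolding p_def diff_conv_add_uminus using q
    by (subst degree_add_eq_left) (simp_all add: degree_monom_eq)
  then have "p \<noteq> 0" using q by auto
  then obtain A where size: "size A = degree p"
    and A: "p = smult (lead_coeff p) (\<Prod>x\<in>#A. [:-x, 1:])"
    using alg_closed_imp_factorization by blast
  define a where "a = lead_coeff p"
  have a: "a \<noteq> 0" "p = smult a (\<Prod>x\<in>#A. [:-x, 1:])"
    using \<open>p \<noteq> 0\<close> A unfolding a_def by simp_all
  have roots: "x ^ q = x \<longleftrightarrow> x \<in># A" for x
  proof -
    have "poly (\<Prod>y\<in>#A. [:-y, 1:]) x = 0 \<longleftrightarrow> x \<in># A"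
      by (induction A) auto
    then have "poly p x = 0 \<longleftrightarrow> x \<in># A" unfolding a(2) using a(1) by simp
    moreover have "poly p x = x ^ q - x" by (simp add: p_def poly_monom)
    ultimately show ?thesis by simp
  qed
  have "count A x = 1" if x: "x \<in># A" for x
  proof (rule ccontr)
    assume 1: "count A x \<noteq> 1"
    obtain B where B: "A = add_mset x B" using multi_member_split[OF x] by blast
    have "x \<in># B" using 1 by (simp add: B)
    then obtain C where C: "B = add_mset x C" using multi_member_split[of x B] by blast
    \<comment> \<open>At a repeated root \<open>x\<close> the cofactor \<open>v\<close> of
      \<open>[:-x, 1:]\<close> still vanishes, hence so does the derivative of
      \<open>p\<close>.\<close>
    define v where "v = [:-x, 1:] * smult a (\<Prod>x\<in>#C. [:-x, 1:])"
    have v: "p = [:-x, 1:] * v"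
      unfolding a(2) B C v_def image_mset_add_mset prod_mset.add_mset mult_smult_right ..
    have "poly (pderiv p) x = poly v x"
      unfolding v pderiv_mult by (simp add: pderiv_pCons)
    also have "\<dots> = 0" by (simp add: v_def)
    finally have "poly (pderiv p) x = 0" .
    then show False by (simp add: deriv)
  qed
  then have "(\<Sum>x\<in>set_mset A. count A x) = (\<Sum>x\<in>set_mset A. 1)"
    by (rule sum.cong[OF refl])
  then have "size A = card (set_mset A)"
    unfolding size_multiset_overloaded_eq by simp
  then show ?thesis using roots size deg by (simp add: q_def)
qed

section \<open>Four-wise independence\<close>

text \<open>Models the Frobenius power of order 3. The coefficient field enters as the elements
  fixed by \<open>\<sigma>\<close>. Order 3 is required pointwise in the lemmas, since on a whole
  algebraic closure the map need not have that order.\<close>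

locale field_endomorphism =
  fixes \<sigma> :: "'c::field \<Rightarrow> 'c"
  assumes add: "\<sigma> (x + y) = \<sigma> x + \<sigma> y"
    and mult: "\<sigma> (x * y) = \<sigma> x * \<sigma> y"
    and one: "\<sigma> 1 = 1"
begin

lemma zero: "\<sigma> 0 = 0"
  using add[of 0 0] by (metis add_cancel_right_right add_0_left)

lemma uminus: "\<sigma> (- x) = - \<sigma> x"
  using add[of x "- x"] zero by (simp add: eq_neg_iff_add_eq_0 add.commute)

lemma diff: "\<sigma> (x - y) = \<sigma> x - \<sigma> y"
  using add[of x "- y"] uminus by simp

lemma eq_0_iff: "\<sigma> x = 0 \<longleftrightarrow> x = 0"
proof
  assume "\<sigma> x = 0"
  show "x = 0"
  proof (rule ccontr)
    assume "x \<noteq> 0"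
    then have "\<sigma> x * \<sigma> (inverse x) = 1" using one by (metis mult right_inverse)
    then show False using \<open>\<sigma> x = 0\<close> by simp
  qed
qed (simp add: zero)

lemma divide: "\<sigma> (x / y) = \<sigma> x / \<sigma> y"
proof (cases "y = 0")
  case False
  then have "\<sigma> (x / y) * \<sigma> y = \<sigma> x" by (metis mult nonzero_eq_divide_eq)
  then show ?thesis using False eq_0_iff by (simp add: nonzero_eq_divide_eq)
qed (simp add: zero)

lemma inject: "\<sigma> x = \<sigma> y \<longleftrightarrow> x = y"
  using eq_0_iff[of "x - y"] by (simp add: diff)

lemma sum: "\<sigma> (sum f A) = (\<Sum>x\<in>A. \<sigma> (f x))"
  by (induction A rule: infinite_finite_induct) (auto simp: zero add)

text \<open>If \<open>b\<close> is nonzero, the first relation gives \<open>y = c * x\<close> with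
  \<open>c\<close> fixed by \<open>\<sigma>\<close>. The second then forces
  \<open>c * (c - 1) = 0\<close>, so \<open>y\<close> would be \<open>0\<close> or
  \<open>x\<close>.\<close>

lemma independent_two:
  assumes fixed: "\<sigma> a = a" "\<sigma> b = b"
    and xy: "x \<noteq> 0" "y \<noteq> 0" "x \<noteq> y"
    and eq: "a * x + b * y = 0" "a * (x * \<sigma> x) + b * (y * \<sigma> y) = 0"
  shows "a = 0 \<and> b = 0"
proof (cases "b = 0")
  case True
  then show ?thesis using xy eq by simp
next
  case False
  define c where "c = - a / b"
  have c: "\<sigma> c = c" "a = - b * c" using fixed False by (simp_all add: c_def divide uminus)
  have "b * y = b * (c * x)" using eq(1) c(2) by (simp add: algebra_simps)
  then have y: "y = c * x" using False by simp
  have "b * (c * (c - 1)) * (x * \<sigma> x) = 0"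
    using eq(2) unfolding y by (simp add: c(2) mult c(1) algebra_simps)
  then have "c = 0 \<or> c = 1" using False xy eq_0_iff by simp
  then show ?thesis using xy y by auto
qed

text \<open>If the three points lie on one line over the fixed field, this is a Vandermonde argument.
  Otherwise the ratio \<open>w\<close> satisfies \<open>A w (\<sigma> w) + B (w + \<sigma> w) + C = 0\<close> with \<open>A, B, C\<close> fixed by \<open>\<sigma>\<close>;
  the relation is symmetric in \<open>w\<close> and \<open>\<sigma> w\<close>, so it would force \<open>\<sigma> (\<sigma> w) = w\<close>,
  which is incompatible with \<open>\<sigma>\<close> having order 3 on \<open>w\<close>.\<close>

lemma independent_three:
  assumes fixed: "\<sigma> a = a" "\<sigma> b = b" "\<sigma> c = c"
    and order: "\<sigma> (\<sigma> (\<sigma> x)) = x" "\<sigma> (\<sigma> (\<sigma> y)) = y"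
    and xyz: "x \<noteq> 0" "y \<noteq> 0" "z \<noteq> 0" "x \<noteq> y" "x \<noteq> z" "y \<noteq> z"
    and eq1: "a * x + b * y + c * z = 0"
    and eq2: "a * (x * \<sigma> x) + b * (y * \<sigma> y) + c * (z * \<sigma> z) = 0"
    and eq3: "a * (x * \<sigma> x * \<sigma> (\<sigma> x)) + b * (y * \<sigma> y * \<sigma> (\<sigma> y)) + c * (z * \<sigma> z * \<sigma> (\<sigma> z)) = 0"
  shows "c = 0"
proof (rule ccontr)
  assume c: "c \<noteq> 0"
  define u v w where "u = - a / c" and "v = - b / c" and "w = x / y"
  have fixed': "\<sigma> u = u" "\<sigma> v = v" by (simp_all add: u_def v_def divide uminus fixed)
  have ab: "a = - c * u" "b = - c * v" using c by (simp_all add: u_def v_def)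
  have x: "x = w * y" using xyz by (simp add: w_def)
  have "c * z = c * (u * x + v * y)" using eq1 by (simp add: ab algebra_simps)
  then have z: "z = (u * w + v) * y" using c by (simp add: x distrib_right mult.assoc)
  have \<sigma>y: "\<sigma> y \<noteq> 0" "\<sigma> (\<sigma> y) \<noteq> 0" using xyz by (simp_all add: eq_0_iff)
  show False
  proof (cases "\<sigma> w = w")
    case True
    \<comment> \<open>Now \<open>x\<close>, \<open>y\<close>, \<open>z\<close> are the multiples of
      \<open>y\<close> by \<open>w\<close>, \<open>1\<close>, \<open>p\<close>, all fixed by
      \<open>\<sigma>\<close>, so the relations become weighted power sums of these three
      nodes.\<close>
    define p where "p = u * w + v"
    have p: "\<sigma> p = p" "z = p * y" using z by (simp_all add: p_def add mult fixed' True)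
    have "(a * w + b + c * p) * y = 0"
      using eq1 by (simp add: x p algebra_simps)
    then have 1: "a * w + b + c * p = 0" using xyz by simp
    have "(a * w^2 + b + c * p^2) * (y * \<sigma> y) = 0"
      using eq2 by (simp add: x p mult True power2_eq_square algebra_simps)
    then have 2: "a * w^2 + b + c * p^2 = 0" using xyz \<sigma>y by simp
    have "(a * w^3 + b + c * p^3) * (y * \<sigma> y * \<sigma> (\<sigma> y)) = 0"
      using eq3 by (simp add: x p mult True power3_eq_cube algebra_simps)
    then have 3: "a * w^3 + b + c * p^3 = 0" using xyz \<sigma>y by simp
    \<comment> \<open>The power sums are combined according to the cubic X (X - 1) (X - w), which
      vanishes at the nodes \<open>1\<close> and \<open>w\<close> and leaves only the term of
      \<open>p\<close>.\<close>
    have "c * (p * (p - 1) * (p - w)) = (a * w^3 + b + c * p^3)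
        - (1 + w) * (a * w^2 + b + c * p^2) + w * (a * w + b + c * p)"
      by (simp add: algebra_simps power2_eq_square power3_eq_cube)
    then have "p = 0 \<or> p = 1 \<or> p = w" using 1 2 3 c by simp
    then show False using xyz p(2) x by auto
  next
    case False
    \<comment> \<open>These coefficients remain when \<open>z = u * x + v * y\<close> is put into
      the second relation, which is then divided by \<open>c * (y * \<sigma> y)\<close>.\<close>
    define A B C where "A = u^2 - u" and "B = u * v" and "C = v^2 - v"
    have ABC: "\<sigma> A = A" "\<sigma> B = B" "\<sigma> C = C"
      by (simp_all add: A_def B_def C_def diff mult fixed' power2_eq_square)
    have "c * (A * w * \<sigma> w + B * (w + \<sigma> w) + C) * (y * \<sigma> y) = 0"
      using eq2 by (simp add: ab x z mult add fixed' A_def B_def C_def power2_eq_square algebra_simps)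
    then have rel: "A * w * \<sigma> w + B * (w + \<sigma> w) + C = 0" using c xyz \<sigma>y by simp
    have w3: "\<sigma> (\<sigma> (\<sigma> w)) = w" by (simp add: w_def divide order)
    have rel': "A * \<sigma> w * \<sigma> (\<sigma> w) + B * (\<sigma> w + \<sigma> (\<sigma> w)) + C = 0"
      using arg_cong[OF rel, of \<sigma>] by (simp add: add mult ABC zero)
    have rel'': "A * \<sigma> (\<sigma> w) * w + B * (\<sigma> (\<sigma> w) + w) + C = 0"
      using arg_cong[OF rel', of \<sigma>] by (simp add: add mult ABC zero w3)
    have ne: "\<sigma> (\<sigma> w) \<noteq> \<sigma> w" "\<sigma> (\<sigma> w) \<noteq> w" using False w3 inject by metis+
    \<comment> \<open>The relation is affine in each of its two arguments, so the difference of two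
      conjugate relations sharing an argument splits into factors.\<close>
    have "(w - \<sigma> (\<sigma> w)) * (A * \<sigma> w + B) = (A * w * \<sigma> w + B * (w + \<sigma> w) + C)
        - (A * \<sigma> w * \<sigma> (\<sigma> w) + B * (\<sigma> w + \<sigma> (\<sigma> w)) + C)"
      by (simp add: algebra_simps)
    then have 1: "A * \<sigma> w + B = 0" using ne rel rel' by simp
    have "(\<sigma> w - \<sigma> (\<sigma> w)) * (A * w + B) = (A * w * \<sigma> w + B * (w + \<sigma> w) + C)
        - (A * \<sigma> (\<sigma> w) * w + B * (\<sigma> (\<sigma> w) + w) + C)"
      by (simp add: algebra_simps)
    then have 2: "A * w + B = 0" using ne rel rel'' by simp
    have "A * (w - \<sigma> w) = (A * w + B) - (A * \<sigma> w + B)" by (simp add: algebra_simps)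
    then have "A = 0" using False 1 2 by simp
    moreover have "B = 0" using 2 calculation by simp
    ultimately have "A = 0" "B = 0" "C = 0" using rel by simp_all
    \<comment> \<open>So \<open>u * x + v * y\<close>, which equals \<open>z\<close>, is one of
      \<open>0\<close>, \<open>x\<close>, \<open>y\<close>.\<close>
    then have "u = 0 \<or> u = 1" "v = 0 \<or> v = 1" "u = 0 \<or> v = 0"
      by (auto simp: A_def B_def C_def power2_eq_square)
    then show False using xyz z x by auto
  qed
qed

text \<open>Expansion leaves sums of \<open>c j\<close> times products of conjugates of
  \<open>x j\<close>. Each is a given relation or its image under one or two applications of
  \<open>\<sigma>\<close>, the coefficients being fixed; order 3 turns the second conjugate of
  \<open>x j * \<sigma> (x j)\<close> into \<open>\<sigma> (\<sigma> (x j)) * x j\<close>.\<close>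

lemma sums_translate:
  assumes fixed: "\<And>j. j \<in> J \<Longrightarrow> \<sigma> (c j) = c j"
    and order: "\<And>j. j \<in> J \<Longrightarrow> \<sigma> (\<sigma> (\<sigma> (x j))) = x j"
    and eqs: "(\<Sum>j\<in>J. c j) = 0" "(\<Sum>j\<in>J. c j * x j) = 0" "(\<Sum>j\<in>J. c j * (x j * \<sigma> (x j))) = 0"
      "(\<Sum>j\<in>J. c j * (x j * \<sigma> (x j) * \<sigma> (\<sigma> (x j)))) = 0"
  shows "(\<Sum>j\<in>J. c j * (x j - p)) = 0"
    "(\<Sum>j\<in>J. c j * ((x j - p) * \<sigma> (x j - p))) = 0"
    "(\<Sum>j\<in>J. c j * ((x j - p) * \<sigma> (x j - p) * \<sigma> (\<sigma> (x j - p)))) = 0"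
proof -
  have s1: "(\<Sum>j\<in>J. c j * \<sigma> (x j)) = 0"
    using arg_cong[OF eqs(2), of \<sigma>] by (simp add: sum mult zero fixed)
  have s2: "(\<Sum>j\<in>J. c j * \<sigma> (\<sigma> (x j))) = 0"
    using arg_cong[OF s1, of \<sigma>] by (simp add: sum mult zero fixed)
  have s3: "(\<Sum>j\<in>J. c j * (\<sigma> (x j) * \<sigma> (\<sigma> (x j)))) = 0"
    using arg_cong[OF eqs(3), of \<sigma>] by (simp add: sum mult zero fixed)
  have s4: "(\<Sum>j\<in>J. c j * (\<sigma> (\<sigma> (x j)) * x j)) = 0"
    using arg_cong[OF s3, of \<sigma>] by (simp add: sum mult zero fixed order)
  show "(\<Sum>j\<in>J. c j * (x j - p)) = 0"
    using eqs by (simp add: right_diff_distrib sum_subtractf flip: sum_distrib_right)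
  have "(\<Sum>j\<in>J. c j * ((x j - p) * \<sigma> (x j - p))) =
      (\<Sum>j\<in>J. c j * (x j * \<sigma> (x j)) - c j * x j * \<sigma> p - c j * \<sigma> (x j) * p + c j * (p * \<sigma> p))"
    by (intro sum.cong) (auto simp: diff algebra_simps)
  also have "\<dots> = 0"
    using eqs s1 by (simp add: sum.distrib sum_subtractf flip: sum_distrib_right)
  finally show "(\<Sum>j\<in>J. c j * ((x j - p) * \<sigma> (x j - p))) = 0" .
  have "(\<Sum>j\<in>J. c j * ((x j - p) * \<sigma> (x j - p) * \<sigma> (\<sigma> (x j - p)))) =
      (\<Sum>j\<in>J. c j * (x j * \<sigma> (x j) * \<sigma> (\<sigma> (x j)))
        - c j * (x j * \<sigma> (x j)) * \<sigma> (\<sigma> p) - c j * (\<sigma> (x j) * \<sigma> (\<sigma> (x j))) * p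
        - c j * (\<sigma> (\<sigma> (x j)) * x j) * \<sigma> p
        + c j * x j * (\<sigma> p * \<sigma> (\<sigma> p)) + c j * \<sigma> (x j) * (p * \<sigma> (\<sigma> p))
        + c j * \<sigma> (\<sigma> (x j)) * (p * \<sigma> p) - c j * (p * \<sigma> p * \<sigma> (\<sigma> p)))"
    by (intro sum.cong) (auto simp: diff algebra_simps)
  also have "\<dots> = 0"
    using eqs s1 s2 s3 s4 by (simp add: sum.distrib sum_subtractf flip: sum_distrib_right)
  finally show "(\<Sum>j\<in>J. c j * ((x j - p) * \<sigma> (x j - p) * \<sigma> (\<sigma> (x j - p)))) = 0" .
qed

text \<open>Translating by one of the points removes its term and leaves at most three distinct
  nonzero points, where the previous independence lemmas apply. If \<open>J\<close> is a single
  point, the sum of the coefficients already gives the contradiction.\<close>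

lemma no_relation_card_le_4:
  assumes J: "finite J" "J \<noteq> {}" "card J \<le> 4" and inj: "inj_on x J"
    and c: "\<And>j. j \<in> J \<Longrightarrow> \<sigma> (c j) = c j" "\<And>j. j \<in> J \<Longrightarrow> c j \<noteq> 0"
    and order: "\<And>j. j \<in> J \<Longrightarrow> \<sigma> (\<sigma> (\<sigma> (x j))) = x j"
    and eqs: "(\<Sum>j\<in>J. c j) = 0" "(\<Sum>j\<in>J. c j * x j) = 0" "(\<Sum>j\<in>J. c j * (x j * \<sigma> (x j))) = 0"
      "(\<Sum>j\<in>J. c j * (x j * \<sigma> (x j) * \<sigma> (\<sigma> (x j)))) = 0"
  shows False
proof -
  obtain i where i: "i \<in> J" using J by auto
  define J' where "J' = J - {i}"
  define y where "y j = x j - x i" for j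
  have drop: "(\<Sum>j\<in>J'. f j) = (\<Sum>j\<in>J. f j)" if "f i = 0" for f :: "_ \<Rightarrow> 'c"
    unfolding J'_def using J i that by (simp add: sum.remove)
  note tr = sums_translate[OF c(1) order eqs, of "x i"]
  have e: "(\<Sum>j\<in>J'. c j * y j) = 0" "(\<Sum>j\<in>J'. c j * (y j * \<sigma> (y j))) = 0"
    "(\<Sum>j\<in>J'. c j * (y j * \<sigma> (y j) * \<sigma> (\<sigma> (y j)))) = 0"
    using tr by (subst drop; simp add: y_def)+
  have y: "y j \<noteq> 0" if "j \<in> J'" for j
    using that inj i unfolding J'_def y_def by (auto dest: inj_onD)
  have yinj: "y j \<noteq> y j'" if "j \<in> J'" "j' \<in> J'" "j \<noteq> j'" for j j'
    using that inj unfolding J'_def y_def by (auto dest: inj_onD)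
  have yorder: "\<sigma> (\<sigma> (\<sigma> (y j))) = y j" if "j \<in> J'" for j
    using that order i by (simp add: y_def J'_def diff)
  have c': "\<sigma> (c j) = c j" "c j \<noteq> 0" if "j \<in> J'" for j
    using that c by (auto simp: J'_def)
  have fin: "finite J'" "card J' \<le> 3" using J i by (auto simp: J'_def)
  then consider "card J' = 0" | "card J' = 1" | "card J' = 2" | "card J' = 3" by linarith
  then show False
  proof cases
    case 1
    then have "J = {i}" using fin(1) i unfolding J'_def by (metis card_0_eq insert_Diff)
    then show False using eqs(1) c(2) by auto
  next
    case 2
    then obtain j where "J' = {j}" by (auto simp: card_1_singleton_iff)
    then show False using e(1) y[of j] c'(2)[of j] by auto
  next
    case 3
    then obtain j l where jl: "J' = {j, l}" "j \<noteq> l" by (auto simp: card_2_iff)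
    show False
      using independent_two[of "c j" "c l" "y j" "y l"] e c'[of j] c'[of l] y[of j] y[of l] yinj[of j l] jl
      by auto
  next
    case 4
    then obtain j l n where jln: "J' = {j, l, n}" "j \<noteq> l" "j \<noteq> n" "l \<noteq> n"
      by (auto simp: card_3_iff)
    show False
      using independent_three[of "c j" "c l" "c n" "y j" "y l" "y n"] e c'[of j] c'[of l] c'[of n]
        y[of j] y[of l] y[of n] yinj[of j l] yinj[of j n] yinj[of l n] yorder[of j] yorder[of l] jln
      by (auto simp: add.assoc)
  qed
qed

end

section \<open>Moore matrices\<close>

text \<open>Induction on \<open>J\<close>. Scaling the coefficient of \<open>n\<close> to 1 and
  eliminating it yields a smaller Moore system in the squares of \<open>a\<close>, with unknowns
  \<open>z j ^ 2 - z j\<close>. Hence every \<open>z j\<close> is 0 or 1, and a linear relation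
  becomes a vanishing subset sum.\<close>

lemma Moore_kernel_trivial:
  fixes a y :: "'i \<Rightarrow> 'a::field"
  assumes char2: "CHAR('a) = 2" and "finite J"
    and "\<And>I. I \<subseteq> J \<Longrightarrow> I \<noteq> {} \<Longrightarrow> sum a I \<noteq> 0"
    and "\<And>e. e < card J \<Longrightarrow> (\<Sum>j\<in>J. a j ^ (2 ^ e) * y j) = 0"
  shows "\<forall>j\<in>J. y j = 0"
  using assms(2-)
proof (induction J arbitrary: a y rule: finite_induct)
  case empty
  then show ?case by simp
next
  case (insert n J)
  have sq_sum: "sum f A ^ 2 = (\<Sum>i\<in>A. f i ^ 2)" for f :: "'i \<Rightarrow> 'a" and A
    using char2 by (intro freshmans_dream_sum) auto
  have sq_add: "(u + v) ^ 2 = u ^ 2 + v ^ 2" for u v :: 'a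
    using char2 by (intro freshmans_dream) auto
  have rel: "a n ^ (2 ^ e) * y n + (\<Sum>j\<in>J. a j ^ (2 ^ e) * y j) = 0" if "e \<le> card J" for e
    using insert.prems(2)[of e] insert.hyps that by simp
  have yn: "y n = 0"
  proof (rule ccontr)
    assume yn: "y n \<noteq> 0"
    define z where "z j = y j / y n" for j
    have relz: "a n ^ (2 ^ e) + (\<Sum>j\<in>J. a j ^ (2 ^ e) * z j) = 0" if "e \<le> card J" for e
    proof -
      have "a n ^ (2 ^ e) + (\<Sum>j\<in>J. a j ^ (2 ^ e) * z j)
          = (a n ^ (2 ^ e) * y n + (\<Sum>j\<in>J. a j ^ (2 ^ e) * y j)) / y n"
        using yn by (simp add: z_def add_divide_distrib sum_divide_distrib)
      then show ?thesis using rel[OF that] by simp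
    qed
    \<comment> \<open>Squaring relation \<open>e\<close> and subtracting relation \<open>e + 1\<close> eliminates \<open>n\<close>.\<close>
    have pow2: "(u ^ 2) ^ (2 ^ e) = u ^ (2 ^ Suc e)" "(u ^ (2 ^ e)) ^ 2 = u ^ (2 ^ Suc e)" for u :: 'a and e
      by (metis power_Suc power_mult, metis power_Suc2 power_mult)
    have "(\<Sum>j\<in>J. (a j ^ 2) ^ (2 ^ e) * (z j ^ 2 - z j)) = 0" if "e < card J" for e
    proof -
      have "(a n ^ (2 ^ e) + (\<Sum>j\<in>J. a j ^ (2 ^ e) * z j)) ^ 2 = 0" using relz[of e] that by simp
      then have "(a n ^ (2 ^ e)) ^ 2 + (\<Sum>j\<in>J. (a j ^ (2 ^ e) * z j) ^ 2) = 0"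
        unfolding sq_add sq_sum .
      then have "a n ^ (2 ^ Suc e) + (\<Sum>j\<in>J. a j ^ (2 ^ Suc e) * z j ^ 2) = 0"
        by (simp only: power_mult_distrib pow2)
      moreover have "a n ^ (2 ^ Suc e) + (\<Sum>j\<in>J. a j ^ (2 ^ Suc e) * z j) = 0"
        using relz[of "Suc e"] that by simp
      ultimately have "(\<Sum>j\<in>J. a j ^ (2 ^ Suc e) * z j ^ 2) = (\<Sum>j\<in>J. a j ^ (2 ^ Suc e) * z j)"
        by (metis add_left_imp_eq)
      then show ?thesis
        by (simp only: pow2 right_diff_distrib sum_subtractf) simp
    qed
    \<comment> \<open>Squaring is additive, so the squares inherit independence.\<close>
    moreover have "(\<Sum>j\<in>I. a j ^ 2) \<noteq> 0" if "I \<subseteq> J" "I \<noteq> {}" for I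
      using insert.prems(1)[of I] that by (simp add: subset_insertI2 flip: sq_sum)
    ultimately have "\<forall>j\<in>J. z j ^ 2 - z j = 0"
      by (intro insert.IH[of "\<lambda>j. a j ^ 2" "\<lambda>j. z j ^ 2 - z j"]) auto
    then have z01: "z j = 0 \<or> z j = 1" if "j \<in> J" for j
      using that by (auto simp: power2_eq_square)
    \<comment> \<open>Relation 0 now says that \<open>a\<close> sums to zero over
      \<open>insert n I\<close>.\<close>
    define I where "I = {j\<in>J. z j = 1}"
    have "(\<Sum>j\<in>J. a j * z j) = (\<Sum>j\<in>I. a j)"
      unfolding I_def using insert.hyps(1) z01
      by (subst sum.inter_filter) (auto intro!: sum.cong dest: z01)
    then have "a n + sum a I = 0" using relz[of 0] by simp
    moreover have "sum a (insert n I) = a n + sum a I"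
      using insert.hyps by (intro sum.insert) (auto simp: I_def)
    moreover have "sum a (insert n I) \<noteq> 0"
      using insert.prems(1)[of "insert n I"] by (auto simp: I_def)
    ultimately show False by simp
  qed
  have "\<forall>j\<in>J. y j = 0"
  proof (rule insert.IH)
    show "sum a I \<noteq> 0" if "I \<subseteq> J" "I \<noteq> {}" for I using insert.prems(1)[of I] that by auto
    show "(\<Sum>j\<in>J. a j ^ (2 ^ e) * y j) = 0" if "e < card J" for e using rel[of e] that yn by simp
  qed
  then show ?case using yn by simp
qed

section \<open>From independent evaluation points to maximally recoverable codes\<close>

definition supported_on :: "nat set \<Rightarrow> (nat \<Rightarrow> 'a::zero) set" where
  "supported_on T = {c. \<forall>i. i \<notin> T \<longrightarrow> c i = 0}"

lemma supported_on_card: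
  assumes "finite T"
  shows "finite (supported_on T :: (nat \<Rightarrow> 'a::{finite,zero}) set)"
    and "card (supported_on T :: (nat \<Rightarrow> 'a) set) = card (UNIV :: 'a set) ^ card T"
proof -
  have "bij_betw (\<lambda>f i. if i \<in> T then f i else 0) (T \<rightarrow>\<^sub>E (UNIV :: 'a set)) (supported_on T)"
    by (rule bij_betw_byWitness[where f' = "\<lambda>f. restrict f T"])
      (auto simp: supported_on_def fun_eq_iff PiE_def extensional_def)
  then have "finite (T \<rightarrow>\<^sub>E (UNIV :: 'a set)) = finite (supported_on T :: (nat \<Rightarrow> 'a) set)"
    "card (T \<rightarrow>\<^sub>E (UNIV :: 'a set)) = card (supported_on T :: (nat \<Rightarrow> 'a) set)"
    by (rule bij_betw_finite, rule bij_betw_same_card)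
  moreover have "finite (T \<rightarrow>\<^sub>E (UNIV :: 'a set))"
    using assms by (intro finite_PiE) auto
  moreover have "card (T \<rightarrow>\<^sub>E (UNIV :: 'a set)) = card (UNIV :: 'a set) ^ card T"
    using assms by (simp add: card_PiE)
  ultimately show "finite (supported_on T :: (nat \<Rightarrow> 'a) set)"
    "card (supported_on T :: (nat \<Rightarrow> 'a) set) = card (UNIV :: 'a set) ^ card T"
    by simp_all
qed

lemma data_vectors_supported_on: "data_vectors k = supported_on {..<k}"
  by (auto simp: data_vectors_def supported_on_def)

text \<open>An injective self-map of a finite set is onto, so the trivial kernel gives solvability.
  The solutions serve as heavy parity coefficients.\<close>

lemma Moore_system_solvable:
  fixes a :: "nat \<Rightarrow> 'a::{finite,field}"
  assumes char2: "CHAR('a) = 2"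
    and indep: "\<And>I. I \<subseteq> {..<h} \<Longrightarrow> I \<noteq> {} \<Longrightarrow> sum a I \<noteq> 0"
  shows "\<exists>y. \<forall>e<h. (\<Sum>j<h. a j ^ (2 ^ e) * y j) = b e"
proof -
  define F where "F y = (\<lambda>e. if e < h then \<Sum>j<h. a j ^ (2 ^ e) * y j else 0)" for y
  have "inj_on F (supported_on {..<h})"
  proof (rule inj_onI)
    fix y z assume yz: "y \<in> supported_on {..<h}" "z \<in> supported_on {..<h}" "F y = F z"
    have "(\<Sum>j<h. a j ^ (2 ^ e) * (y j - z j)) = 0" if "e < h" for e
      using fun_cong[OF yz(3), of e] that by (simp add: F_def right_diff_distrib sum_subtractf)
    then have "\<forall>j\<in>{..<h}. y j - z j = 0"
      by (intro Moore_kernel_trivial[OF char2 finite_lessThan indep]) simp_all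
    then have "y j = z j" for j
      using yz(1,2) by (cases "j < h") (auto simp: supported_on_def)
    then show "y = z" by (rule ext)
  qed
  moreover have "F ` supported_on {..<h} \<subseteq> supported_on {..<h}"
    by (auto simp: F_def supported_on_def)
  ultimately have "F ` supported_on {..<h} = supported_on {..<h}"
    using endo_inj_surj[OF supported_on_card(1)[OF finite_lessThan]] by blast
  moreover have "(\<lambda>e. if e < h then b e else 0) \<in> supported_on {..<h}"
    by (auto simp: supported_on_def)
  ultimately have "(\<lambda>e. if e < h then b e else 0) \<in> F ` supported_on {..<h}" by simp
  then obtain y where y: "(\<lambda>e. if e < h then b e else 0) = F y" by (rule imageE)
  have "(\<Sum>j<h. a j ^ (2 ^ e) * y j) = b e" if "e < h" for e
    using fun_cong[OF y, of e] that by (simp add: F_def)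
  then show ?thesis by blast
qed

lemma local_encode_diff:
  "local_encode k r h H g (\<lambda>i. x i - y i) i = local_encode k r h H g x i - local_encode k r h H g y i"
proof -
  have "sys_part k h H (\<lambda>i. x i - y i) i = sys_part k h H x i - sys_part k h H y i" for i
    by (simp add: sys_part_def right_diff_distrib sum_subtractf)
  then show ?thesis by (simp add: local_encode_def sum_subtractf)
qed

definition group_of :: "nat \<Rightarrow> nat \<Rightarrow> (nat \<Rightarrow> nat) \<Rightarrow> nat \<Rightarrow> nat" where
  "group_of k h g i = (if i < k + h then g i else i - (k + h))"

lemma local_group_conv_group_of:
  assumes "valid_grouping k r h g" "j < (k + h) div r"
  shows "local_group k h g j = {i \<in> {..<code_length k r h}. group_of k h g i = j}"
  using assms by (auto simp: local_group_def code_length_def group_of_def)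

text \<open>Eliminating the coordinate \<open>e j\<close> of every group by its local parity check turns the column of
  coordinate \<open>i\<close> in the heavy checks into the Frobenius powers of \<open>\<alpha> i + \<alpha> (e (group_of k h g i))\<close>.\<close>

definition independent_points ::
  "nat \<Rightarrow> nat \<Rightarrow> nat \<Rightarrow> (nat \<Rightarrow> nat) \<Rightarrow> (nat \<Rightarrow> 'a::field) \<Rightarrow> bool" where
  "independent_points k r h g \<alpha> \<longleftrightarrow>
     (\<forall>e I. (\<forall>j<(k + h) div r. e j \<in> local_group k h g j) \<longrightarrow> I \<subseteq> {..<code_length k r h} \<longrightarrow>
        I \<noteq> {} \<longrightarrow> card I \<le> h \<longrightarrow> (\<forall>i\<in>I. e (group_of k h g i) \<noteq> i) \<longrightarrow>
        (\<Sum>i\<in>I. \<alpha> i + \<alpha> (e (group_of k h g i))) \<noteq> 0)"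

text \<open>The heavy parities are chosen so that all codewords satisfy the heavy checks. A codeword
  with at most \<open>h\<close> nonzero symbols outside \<open>E\<close> then lies in the kernel of
  a Moore matrix with independent generators, so it vanishes. Pigeonhole gives the matching upper
  bound on the distance.\<close>

lemma independent_points_maximally_recoverable:
  fixes \<alpha> :: "nat \<Rightarrow> 'a::{finite,field}"
  assumes char2: "CHAR('a) = 2" and k: "0 < k" and g: "valid_grouping k r h g"
    and ind: "independent_points k r h g \<alpha>" and parity: "\<And>i. k + h \<le> i \<Longrightarrow> \<alpha> i = 0"
  shows "\<exists>H :: nat \<Rightarrow> nat \<Rightarrow> 'a. maximally_recoverable k r h H g"
proof -
  define l where "l = (k + h) div r"
  define N where "N = code_length k r h"
  define G where "G = group_of k h g"
  have N: "N = k + h + l" by (simp add: N_def l_def code_length_def)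
  have dbl: "x + x = 0" for x :: 'a
    using minus_CHAR_2[OF char2, of x x] by simp
  have gl: "g i < l" if "i < k + h" for i using g that by (auto simp: valid_grouping_def l_def)
  have Gl: "G i < l" if "i < N" for i using that gl by (auto simp: G_def group_of_def N)
  have grp: "local_group k h g j = {i \<in> {..<N}. G i = j}" if "j < l" for j
    using local_group_conv_group_of[OF g] that unfolding l_def N_def G_def by simp
  have frob: "(x + y) ^ (2 ^ e) = x ^ (2 ^ e) + y ^ (2 ^ e)" for x y :: 'a and e
    using char2 by (intro freshmans_dream'[of _ e]) auto
  have ind': "(\<Sum>i\<in>I. \<alpha> i + \<alpha> (e (G i))) \<noteq> 0"
    if "\<And>j. j < l \<Longrightarrow> e j \<in> local_group k h g j" "I \<subseteq> {..<N}" "I \<noteq> {}" "card I \<le> h"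
      "\<And>i. i \<in> I \<Longrightarrow> e (G i) \<noteq> i" for e I
    using ind[unfolded independent_points_def, rule_format, of e I] that
    unfolding l_def N_def G_def by simp

  \<comment> \<open>Independence of the points of the heavy parities is the case where
    \<open>e\<close> selects every local parity, whose point is 0.\<close>
  have "\<exists>y. \<forall>e<h. (\<Sum>j<h. \<alpha> (k + j) ^ (2 ^ e) * y j) = \<alpha> i ^ (2 ^ e)" for i
  proof (rule Moore_system_solvable[OF char2])
    fix I assume I: "I \<subseteq> {..<h}" "I \<noteq> {}"
    have "card I \<le> h" using I(1) by (metis card_lessThan card_mono finite_lessThan)
    then have "(\<Sum>i\<in>(+) k ` I. \<alpha> i + \<alpha> (k + h + G i)) \<noteq> 0"
      using I by (intro ind'[where e = "\<lambda>j. k + h + j"]) (auto simp: local_group_def N card_image)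
    then show "(\<Sum>j\<in>I. \<alpha> (k + j)) \<noteq> 0"
      by (simp add: parity sum.reindex)
  qed
  then have "\<exists>y. \<forall>i. \<forall>e<h. (\<Sum>j<h. \<alpha> (k + j) ^ (2 ^ e) * y i j) = \<alpha> i ^ (2 ^ e)"
    by (intro choice) blast
  then obtain y where y: "\<And>i e. e < h \<Longrightarrow> (\<Sum>j<h. \<alpha> (k + j) ^ (2 ^ e) * y i j) = \<alpha> i ^ (2 ^ e)"
    by blast
  define H where "H j i = y i j" for j i
  let ?c = "local_encode k r h H g"

  have split: "(\<Sum>i<k + n. f i) = (\<Sum>i<k. f i) + (\<Sum>j<n. f (k + j))" for f :: "nat \<Rightarrow> 'a" and n
    by (induction n) (simp_all add: add.assoc)
  \<comment> \<open>Local parities drop out because their points are 0. By the choice of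
    \<open>y\<close>, the heavy parities contribute the same sum as the data symbols, and the two
    cancel.\<close>
  have heavy: "(\<Sum>i<N. \<alpha> i ^ (2 ^ e) * ?c x i) = 0" if "e < h" for x e
  proof -
    have "(\<Sum>i<N. \<alpha> i ^ (2 ^ e) * ?c x i) = (\<Sum>i<k + h. \<alpha> i ^ (2 ^ e) * ?c x i)"
      by (rule sum.mono_neutral_right) (auto simp: N parity power_0_left)
    also have "\<dots> = (\<Sum>i<k. \<alpha> i ^ (2 ^ e) * ?c x i) + (\<Sum>j<h. \<alpha> (k + j) ^ (2 ^ e) * ?c x (k + j))"
      by (rule split)
    also have "(\<Sum>i<k. \<alpha> i ^ (2 ^ e) * ?c x i) = (\<Sum>i<k. \<alpha> i ^ (2 ^ e) * x i)"
      by (intro sum.cong) (auto simp: local_encode_def sys_part_def)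
    also have "(\<Sum>j<h. \<alpha> (k + j) ^ (2 ^ e) * ?c x (k + j)) =
        (\<Sum>j<h. \<Sum>i<k. \<alpha> (k + j) ^ (2 ^ e) * y i j * x i)"
      by (intro sum.cong) (auto simp: local_encode_def sys_part_def H_def sum_distrib_left mult.assoc)
    also have "\<dots> = (\<Sum>i<k. (\<Sum>j<h. \<alpha> (k + j) ^ (2 ^ e) * y i j) * x i)"
      by (subst sum.swap) (simp add: sum_distrib_right)
    also have "\<dots> = (\<Sum>i<k. \<alpha> i ^ (2 ^ e) * x i)" using y[OF that] by simp
    finally show ?thesis by (simp add: dbl)
  qed
  have loc: "(\<Sum>i | i \<in> {..<N} \<and> G i = j. ?c x i) = 0" if "j < l" for x j
  proof -
    have "(\<Sum>i | i \<in> {..<N} \<and> G i = j. ?c x i) = (\<Sum>i\<in>local_group k h g j. ?c x i)"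
      using grp[OF that] by simp
    also have "\<dots> = ?c x (k + h + j) + (\<Sum>i | i < k + h \<and> g i = j. ?c x i)"
      by (simp add: local_group_def)
    also have "(\<Sum>i | i < k + h \<and> g i = j. ?c x i) = (\<Sum>i | i < k + h \<and> g i = j. sys_part k h H x i)"
      by (intro sum.cong) (auto simp: local_encode_def)
    also have "?c x (k + h + j) = (\<Sum>i | i < k + h \<and> g i = j. sys_part k h H x i)"
      using that by (simp add: local_encode_def l_def)
    finally show ?thesis by (simp add: dbl)
  qed

  have "is_mds_code ({..<N} - E) k (restrict_coords ({..<N} - E) (local_code k r h H g))"
    if E: "E \<subseteq> {..<N}" "\<forall>j<l. card (E \<inter> local_group k h g j) = 1" for E
  proof -
    define S where "S = {..<N} - E"
    have "\<exists>i. E \<inter> local_group k h g j = {i}" if "j < l" for j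
      using E(2) that by (auto simp: card_1_singleton_iff)
    then have "\<exists>e. \<forall>j. j < l \<longrightarrow> E \<inter> local_group k h g j = {e j}" by (intro choice) blast
    then obtain e where e: "\<And>j. j < l \<Longrightarrow> E \<inter> local_group k h g j = {e j}" by blast
    have e_grp: "e j \<in> local_group k h g j" "e j \<in> E" "G (e j) = j" if "j < l" for j
      using e[OF that] grp[OF that] by auto
    have E_iff: "i \<in> E \<longleftrightarrow> e (G i) = i" if "i < N" for i
    proof -
      have "i \<in> local_group k h g (G i)" using grp[OF Gl[OF that]] that by simp
      then show ?thesis using e[OF Gl[OF that]] by (metis IntD1 IntI singletonD singletonI)
    qed
    have "E = e ` {..<l}"
    proof (intro equalityI subsetI)
      fix i assume "i \<in> E"
      then have "i < N" using E(1) by auto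
      then show "i \<in> e ` {..<l}"
        using E_iff[of i] Gl[of i] \<open>i \<in> E\<close> by (intro image_eqI[of _ _ "G i"]) auto
    qed (use e_grp in auto)
    moreover have "inj_on e {..<l}" by (rule inj_on_inverseI[of _ G]) (use e_grp in auto)
    ultimately have "card E = l" by (simp add: card_image)
    then have card_S: "card S = k + h"
      using E(1) finite_subset[OF E(1)] by (simp add: S_def card_Diff_subset N)
    have "finite S" by (simp add: S_def)

    have zero: "?c x i = 0" if w: "card {i \<in> S. ?c x i \<noteq> 0} \<le> h" and "i < N" for x i
    proof -
      define D where "D = {i \<in> S. ?c x i \<noteq> 0}"
      have "\<forall>i\<in>D. ?c x i = 0"
      proof (rule Moore_kernel_trivial[OF char2])
        show "finite D" by (simp add: D_def S_def)
        fix I assume I: "I \<subseteq> D" "I \<noteq> {}"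
        have "card I \<le> h" using w card_mono[OF \<open>finite D\<close> I(1)] by (simp add: D_def)
        then show "(\<Sum>i\<in>I. \<alpha> i + \<alpha> (e (G i))) \<noteq> 0"
          using I e_grp E_iff by (intro ind') (auto simp: D_def S_def subset_iff)
      next
        fix d assume "d < card D"
        then have d: "d < h" using w by (simp add: D_def)
        \<comment> \<open>Passing from \<open>D\<close> to all coordinates adds nothing: on
          \<open>E\<close> the two points coincide and cancel, elsewhere the symbol is 0. The shift
          \<open>\<alpha> (e (G i))\<close> is constant on each group, so the local checks remove
          it.\<close>
        have "(\<Sum>i\<in>D. (\<alpha> i + \<alpha> (e (G i))) ^ (2 ^ d) * ?c x i) =
            (\<Sum>i<N. (\<alpha> i + \<alpha> (e (G i))) ^ (2 ^ d) * ?c x i)"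
          using E_iff by (intro sum.mono_neutral_left) (auto simp: D_def S_def dbl power_0_left)
        also have "\<dots> = (\<Sum>i<N. \<alpha> i ^ (2 ^ d) * ?c x i) + (\<Sum>i<N. \<alpha> (e (G i)) ^ (2 ^ d) * ?c x i)"
          by (simp add: frob distrib_right sum.distrib)
        also have "(\<Sum>i<N. \<alpha> (e (G i)) ^ (2 ^ d) * ?c x i) =
            (\<Sum>j<l. \<Sum>i | i \<in> {..<N} \<and> G i = j. \<alpha> (e (G i)) ^ (2 ^ d) * ?c x i)"
          using Gl by (intro sum.group[symmetric]) auto
        also have "\<dots> = (\<Sum>j<l. \<alpha> (e j) ^ (2 ^ d) * (\<Sum>i | i \<in> {..<N} \<and> G i = j. ?c x i))"
          by (simp add: sum_distrib_left)
        also have "\<dots> = 0" using loc by simp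
        finally show "(\<Sum>i\<in>D. (\<alpha> i + \<alpha> (e (G i))) ^ (2 ^ d) * ?c x i) = 0"
          using heavy[OF d] by simp
      qed
      then have S0: "?c x i = 0" if "i \<in> S" for i using that by (auto simp: D_def)
      show ?thesis
      proof (cases "i \<in> E")
        case True
        \<comment> \<open>The erased symbol is the only one of its group not yet known to be 0, so
          the local check determines it.\<close>
        have "(\<Sum>i' | i' \<in> {..<N} \<and> G i' = G i. ?c x i') = (\<Sum>i'\<in>{i}. ?c x i')"
        proof (rule sum.mono_neutral_right)
          show "\<forall>i'\<in>{i' \<in> {..<N}. G i' = G i} - {i}. ?c x i' = 0"
          proof
            fix i' assume i': "i' \<in> {i' \<in> {..<N}. G i' = G i} - {i}"
            have "i' \<notin> E"
            proof
              assume "i' \<in> E"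
              then have "e (G i) = i'" using E_iff[of i'] i' by simp
              moreover have "e (G i) = i" using E_iff[of i] True \<open>i < N\<close> by simp
              ultimately show False using i' by simp
            qed
            then show "?c x i' = 0" using i' S0 by (simp add: S_def)
          qed
        qed (use \<open>i < N\<close> in auto)
        then show ?thesis using loc[OF Gl[OF \<open>i < N\<close>], of x] by simp
      qed (use S0 \<open>i < N\<close> in \<open>auto simp: S_def\<close>)
    qed

    define R where "R x = (\<lambda>i. if i \<in> S then ?c x i else 0)" for x
    have R_code: "restrict_coords S (local_code k r h H g) = R ` data_vectors k"
      by (simp add: restrict_coords_def local_code_def R_def image_image)
    have weight_R: "hamming_weight S (R x) = card {i \<in> S. ?c x i \<noteq> 0}" for x
      unfolding hamming_weight_def R_def by (intro arg_cong[of _ _ card]) auto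
    have low: "x = (\<lambda>_. 0)" if x: "x \<in> data_vectors k" and w: "hamming_weight S (R x) \<le> h" for x
    proof
      fix i
      show "x i = 0"
      proof (cases "i < k")
        case True
        have "?c x i = 0" by (rule zero) (use w True in \<open>simp_all add: weight_R N\<close>)
        then show ?thesis using True by (simp add: local_encode_def sys_part_def)
      qed (use x in \<open>auto simp: data_vectors_def\<close>)
    qed
    have diff_data: "(\<lambda>i. x i - z i) \<in> data_vectors k"
      if "x \<in> data_vectors k" "z \<in> data_vectors k" for x z :: "nat \<Rightarrow> 'a"
      using that by (auto simp: data_vectors_def)
    have R_diff: "R (\<lambda>i. x i - z i) i = R x i - R z i" for x z i
      by (simp add: R_def local_encode_diff)
    have inj: "inj_on R (data_vectors k)"
    proof (rule inj_onI)
      fix x z assume xz: "x \<in> data_vectors k" "z \<in> data_vectors k" "R x = R z"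
      have "hamming_weight S (R (\<lambda>i. x i - z i)) = 0"
        using xz(3) by (simp add: hamming_weight_def R_diff)
      then have "(\<lambda>i. x i - z i) = (\<lambda>_. 0)" using low diff_data xz by simp
      then show "x = z" by (simp add: fun_eq_iff)
    qed
    have card_data: "finite (data_vectors k :: (nat \<Rightarrow> 'a) set)"
      "card (data_vectors k :: (nat \<Rightarrow> 'a) set) = card (UNIV :: 'a set) ^ k"
      unfolding data_vectors_supported_on by (simp_all add: supported_on_card)
    have card_R: "card (R ` data_vectors k) = card (UNIV :: 'a set) ^ k"
      using card_image[OF inj] card_data by simp

    have card_field: "1 < card (UNIV :: 'a set)"
      using card_mono[of UNIV "{0, 1 :: 'a}"] by simp
    \<comment> \<open>Singleton bound: two distinct codewords agree on \<open>k - 1\<close>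
      coordinates of \<open>S\<close>, and their difference is supported on the other
      \<open>h + 1\<close>.\<close>
    have "\<exists>c\<in>R ` data_vectors k. c \<noteq> (\<lambda>_. 0) \<and> hamming_weight S c \<le> h + 1"
    proof -
      obtain T where T: "T \<subseteq> S" "card T = k - 1"
        using obtain_subset_with_card_n[of "k - 1" S] card_S by (metis diff_le_self le_add1 order_trans)
      have fT: "finite T" using T(1) \<open>finite S\<close> finite_subset by blast
      define P where "P c = (\<lambda>i. if i \<in> T then c i else (0::'a))" for c
      have "P ` R ` data_vectors k \<subseteq> supported_on T" by (auto simp: P_def supported_on_def)
      then have "card (P ` R ` data_vectors k) \<le> card (UNIV :: 'a set) ^ (k - 1)"
        using supported_on_card[OF fT, where 'a = 'a] T(2) by (metis card_mono)
      also have "\<dots> < card (R ` data_vectors k)"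
        unfolding card_R using k card_field by (intro power_strict_increasing) auto
      finally have "\<not> inj_on P (R ` data_vectors k)"
        using card_image by fastforce
      then obtain x z where xz: "x \<in> data_vectors k" "z \<in> data_vectors k" "R x \<noteq> R z" "P (R x) = P (R z)"
        unfolding inj_on_def by blast
      let ?d = "R (\<lambda>i. x i - z i)"
      have "?d \<in> R ` data_vectors k" using diff_data xz by blast
      moreover have "?d \<noteq> (\<lambda>_. 0)" using xz(3) by (auto simp: fun_eq_iff R_diff)
      moreover have "hamming_weight S ?d \<le> h + 1"
      proof -
        have "{i \<in> S. ?d i \<noteq> 0} \<subseteq> S - T"
          using fun_cong[OF xz(4)] by (auto simp: P_def R_diff) (metis (full_types))
        then have "card {i \<in> S. ?d i \<noteq> 0} \<le> card (S - T)"
          using \<open>finite S\<close> by (intro card_mono) auto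
        also have "\<dots> = h + 1" using T k fT card_S by (simp add: card_Diff_subset)
        finally show ?thesis by (simp add: hamming_weight_def)
      qed
      ultimately show ?thesis by blast
    qed
    moreover have high: "h + 1 \<le> hamming_weight S c"
      if "c \<in> R ` data_vectors k" "c \<noteq> (\<lambda>_. 0)" for c
    proof (rule ccontr)
      obtain x where x: "x \<in> data_vectors k" "c = R x" using \<open>c \<in> R ` data_vectors k\<close> by blast
      assume "\<not> h + 1 \<le> hamming_weight S c"
      then have "x = (\<lambda>_. 0)" using low x by simp
      moreover have "R (\<lambda>_. 0) = (\<lambda>_. 0)"
        using R_diff[of "\<lambda>_. 0" "\<lambda>_. 0"] by (simp add: fun_eq_iff)
      ultimately show False using that x(2) by simp
    qed
    ultimately have "min_distance S (R ` data_vectors k) = h + 1"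
      unfolding min_distance_def using card_data(1)
      by (intro Min_eqI) (auto intro!: finite_image_set le_antisym)
    then show ?thesis
      using card_R card_S unfolding S_def[symmetric] is_mds_code_def R_code by simp
  qed
  then have "maximally_recoverable k r h H g"
    unfolding maximally_recoverable_def l_def N_def by blast
  then show ?thesis by blast
qed

section \<open>The construction\<close>

lemma valid_grouping_div:
  assumes "0 < r" "r dvd k + h"
  shows "valid_grouping k r h (\<lambda>i. i div r)"
proof -
  define l where "l = (k + h) div r"
  have l: "k + h = l * r" using assms by (simp add: l_def)
  have "{i. i < k + h \<and> i div r = j} = {j * r..<j * r + r}" if "j < l" for j
  proof -
    have le: "Suc j * r \<le> l * r" using that by (intro mult_right_mono) auto
    have iff: "i div r = j \<longleftrightarrow> j * r \<le> i \<and> i < j * r + r" for i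
      using less_eq_div_iff_mult_less_eq[OF assms(1), of j i]
        div_less_iff_less_mult[OF assms(1), of i "Suc j"] by auto
    show ?thesis
      unfolding l iff set_eq_iff mem_Collect_eq atLeastLessThan_iff using le[unfolded mult_Suc]
      by (intro allI) linarith
  qed
  moreover have "i div r < l" if "i < k + h" for i
    using that unfolding l by (rule less_mult_imp_div_less)
  ultimately show ?thesis unfolding valid_grouping_def l_def[symmetric] by simp
qed

lemma power_power_fixed:
  fixes z :: "'a::monoid_mult"
  assumes "z ^ q = z"
  shows "z ^ (q ^ n) = z"
  by (induction n) (simp, simp only: power_Suc power_mult assms)

text \<open>The points \<open>0\<close> (for the local parity) and \<open>b 0, \<dots>, b (r - 1)\<close> of a local group are affinely
  independent over the field with two elements.\<close>

lemma group_difference_sum_nonzero: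
  fixes b :: "nat \<Rightarrow> 'c::field"
  assumes char2: "CHAR('c) = 2" and r: "0 < r"
    and b: "\<And>I. I \<subseteq> {..<r} \<Longrightarrow> I \<noteq> {} \<Longrightarrow> sum b I \<noteq> 0"
    and I: "finite I" "I \<noteq> {}" "e \<notin> I"
    and grp: "\<And>i. i \<in> insert e I \<Longrightarrow> i < n \<Longrightarrow> i div r = j"
      "\<And>i. i \<in> insert e I \<Longrightarrow> \<not> i < n \<Longrightarrow> i = n + j"
  defines "B \<equiv> \<lambda>i. if i < n then b (i mod r) else 0"
  shows "(\<Sum>i\<in>I. B i + B e) \<noteq> 0"
proof -
  \<comment> \<open>\<open>B e\<close> is added \<open>card I\<close> times, so it survives exactly
    when \<open>card I\<close> is odd.\<close>
  define T where "T = (if even (card I) then I else insert e I)"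
  have T: "finite T" "T \<subseteq> insert e I" using I by (auto simp: T_def)
  have "card I \<noteq> 0" using I by simp
  have card_T: "2 \<le> card T"
  proof (cases "even (card I)")
    case True
    then show ?thesis using dvd_imp_le[of 2 "card I"] \<open>card I \<noteq> 0\<close> unfolding T_def by simp
  next
    case False
    then have "card T = Suc (card I)" using I by (simp add: T_def)
    then show ?thesis using \<open>card I \<noteq> 0\<close> by linarith
  qed
  have two: "of_nat (card I) = (if even (card I) then 0 else 1 :: 'c)"
    using of_nat_eq_0_iff_char_dvd[where 'a = 'c, of "card I"]
      of_nat_eq_0_iff_char_dvd[where 'a = 'c, of "card I - 1"] char2 \<open>card I \<noteq> 0\<close>
    by (auto simp: of_nat_diff)
  have "(\<Sum>i\<in>I. B i + B e) = sum B I + of_nat (card I) * B e"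
    by (simp add: sum.distrib)
  also have "\<dots> = sum B T" using I two by (simp add: T_def add.commute)
  also have "\<dots> = (\<Sum>i | i \<in> T \<and> i < n. b (i mod r))"
    using T(1) by (simp add: B_def sum.inter_filter)
  also have "\<dots> = sum b ((\<lambda>i. i mod r) ` {i \<in> T. i < n})"
  proof (subst sum.reindex)
    show "inj_on (\<lambda>i. i mod r) {i \<in> T. i < n}"
    proof (rule inj_onI)
      fix u v assume uv: "u \<in> {i \<in> T. i < n}" "v \<in> {i \<in> T. i < n}" and m: "u mod r = v mod r"
      have "u div r = j" "v div r = j" using uv T(2) by (auto intro!: grp(1))
      then have "u div r = v div r" by simp
      then show "u = v" using m by (metis div_mult_mod_eq)
    qed
  qed simp
  also have "\<dots> \<noteq> 0"
  proof (rule b)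
    show "(\<lambda>i. i mod r) ` {i \<in> T. i < n} \<subseteq> {..<r}" using r by auto
    \<comment> \<open>At most one element of \<open>T\<close> is the local parity, so with two
      elements some basis vector remains in the sum.\<close>
    have "\<not> T \<subseteq> {n + j}"
    proof
      assume "T \<subseteq> {n + j}"
      then have "card T \<le> 1" using card_mono[of "{n + j}" T] by simp
      then show False using card_T by simp
    qed
    then have "{i \<in> T. i < n} \<noteq> {}" using T(2) grp(2) by blast
    then show "(\<lambda>i. i mod r) ` {i \<in> T. i < n} \<noteq> {}" by simp
  qed
  finally show ?thesis .
qed

text \<open>A vanishing sum of differences pulls back along \<open>\<phi>\<close> to a relation
  between the vectors of at most four groups. The coefficient of each group is a nonempty sum of
  differences inside it, hence nonzero, which contradicts four-wise independence.\<close>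

lemma ex_independent_points:
  fixes k r s :: nat
  assumes char2: "CHAR('a::{finite,field}) = 2" and r: "0 < r" "r dvd k + 4"
    and groups: "(k + 4) div r \<le> 2 ^ (r * (3 * s))"
    and card_a: "2 ^ (r * (1 + 7 * s)) \<le> card (UNIV :: 'a set)"
  shows "\<exists>\<alpha> :: nat \<Rightarrow> 'a. independent_points k r 4 (\<lambda>i. i div r) \<alpha> \<and> (\<forall>i\<ge>k + 4. \<alpha> i = 0)"
proof -
  define l where "l = (k + 4) div r"
  define N where "N = code_length k r 4"
  define G where "G = group_of k 4 (\<lambda>i. i div r)"
  have lr: "k + 4 = l * r" using r by (simp add: l_def)
  have N: "N = k + 4 + l" by (simp add: N_def l_def code_length_def)
  have Gl: "G i < l" if "i < N" for i
    using that r(1) unfolding G_def group_of_def N lr by (auto intro: less_mult_imp_div_less)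

  \<comment> \<open>The field with \<open>2 ^ (r * (3 * s))\<close> elements need not lie in
    \<open>'a\<close>, so the vectors are built over the algebraic closure and return to
    \<open>'a\<close> only as an additive group.\<close>
  have char2c: "CHAR('a alg_closure) = 2" using char2 by simp
  have dblc: "z + z = 0" for z :: "'a alg_closure"
    using minus_CHAR_2[OF char2c, of z z] by simp
  have dbla: "z + z = 0" for z :: 'a
    using minus_CHAR_2[OF char2, of z z] by simp
  have frob: "(x + y) ^ (2 ^ n) = x ^ (2 ^ n) + y ^ (2 ^ n)" for x y :: "'a alg_closure" and n
    using char2c by (intro freshmans_dream'[of _ n]) auto
  define F where "F n = {z :: 'a alg_closure. z ^ (2 ^ n) = z}" for n
  have card_F: "card (F n) = 2 ^ n" if "0 < n" for n
    using card_frobenius_fixed[where 'c = "'a alg_closure", of n] that char2c by (simp add: F_def)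
  have F_closed: "0 \<in> F n" "\<And>x y. x \<in> F n \<Longrightarrow> y \<in> F n \<Longrightarrow> x + y \<in> F n"
    "\<And>x y. x \<in> F n \<Longrightarrow> y \<in> F n \<Longrightarrow> x * y \<in> F n" for n
    by (auto simp: F_def frob power_mult_distrib power_0_left)
  have F_mult: "F r \<subseteq> F (r * n)" for n
    using power_power_fixed[of _ "2 ^ r" n] by (auto simp: F_def power_mult)

  define \<sigma> where "\<sigma> z = z ^ (2 ^ (r * s))" for z :: "'a alg_closure"
  interpret E: field_endomorphism \<sigma>
    by unfold_locales (auto simp: \<sigma>_def frob power_mult_distrib)
  have \<sigma>3: "\<sigma> (\<sigma> (\<sigma> z)) = z ^ (2 ^ (r * (3 * s)))" for z
  proof -
    have "r * (3 * s) = r * s + r * s + r * s" by simp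
    then show ?thesis by (simp only: \<sigma>_def power_add power_mult)
  qed
  have \<sigma>_Fr: "\<sigma> z = z" if "z \<in> F r" for z
    using that F_mult[of s] by (auto simp: \<sigma>_def F_def)

  \<comment> \<open>For \<open>s = 0\<close> the exponent conditions are vacuous and do not define finite sets.\<close>
  define L where "L = (if s = 0 then {0} else F (r * (3 * s)))"
  define K where "K = (if s = 0 then {0} else F (r * s))"
  have cards: "card (F r) = 2 ^ r" "card L = 2 ^ (r * (3 * s))" "card K = 2 ^ (r * s)"
    using r card_F by (simp_all add: L_def K_def)
  have L_closed: "0 \<in> L" "\<And>x y. x \<in> L \<Longrightarrow> y \<in> L \<Longrightarrow> x + y \<in> L"
    "\<And>x y. x \<in> L \<Longrightarrow> y \<in> L \<Longrightarrow> x * y \<in> L" "\<And>z x. z \<in> F r \<Longrightarrow> x \<in> L \<Longrightarrow> z * x \<in> L"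
    using F_closed subsetD[OF F_mult] by (auto simp: L_def split: if_splits)
  have K_closed: "0 \<in> K" "\<And>x y. x \<in> K \<Longrightarrow> y \<in> K \<Longrightarrow> x + y \<in> K"
    "\<And>z x. z \<in> F r \<Longrightarrow> x \<in> K \<Longrightarrow> z * x \<in> K"
    using F_closed subsetD[OF F_mult] by (auto simp: K_def split: if_splits)
  have L_order: "\<sigma> (\<sigma> (\<sigma> x)) = x" if "x \<in> L" for x
    using that E.zero by (auto simp: L_def F_def \<sigma>3 split: if_splits)
  have L_\<sigma>: "\<sigma> x \<in> L" if "x \<in> L" for x
  proof (cases "s = 0")
    case False
    then show ?thesis using L_order[OF that] by (simp add: L_def F_def flip: \<sigma>3)
  qed (use that E.zero in \<open>simp add: L_def\<close>)
  \<comment> \<open>This product is the norm down to the field fixed by \<open>\<sigma>\<close>, so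
    the last component takes only \<open>r * s\<close> binary dimensions.\<close>
  have norm_K: "x * \<sigma> x * \<sigma> (\<sigma> x) \<in> K" if "x \<in> L" for x
  proof (cases "s = 0")
    case False
    have "\<sigma> (x * \<sigma> x * \<sigma> (\<sigma> x)) = x * \<sigma> x * \<sigma> (\<sigma> x)"
      using L_order[OF that] by (simp add: E.mult)
    then show ?thesis using False by (simp add: K_def F_def \<sigma>_def)
  qed (use that in \<open>simp add: L_def K_def\<close>)

  \<comment> \<open>The factors have binary dimensions \<open>r\<close>, \<open>3 * r * s\<close>,
    \<open>3 * r * s\<close> and \<open>r * s\<close>.\<close>
  define V where "V = F r \<times> L \<times> L \<times> K"
  have V_closed: "0 \<in> V" "\<And>x y. x \<in> V \<Longrightarrow> y \<in> V \<Longrightarrow> x + y \<in> V"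
    using F_closed L_closed K_closed by (auto simp: V_def zero_prod_def)
  have card_V: "card V = 2 ^ (r * (1 + 7 * s))"
    by (simp add: V_def card_cartesian_product cards algebra_simps flip: power_add)
  have fin: "finite (F r)" "finite L" "finite V"
    using cards card_V by (intro card_ge_0_finite; simp)+
  have dblv: "x + x = 0" for x :: "'a alg_closure \<times> 'a alg_closure \<times> 'a alg_closure \<times> 'a alg_closure"
    by (cases x) (simp add: dblc zero_prod_def)
  obtain \<phi> :: "_ \<Rightarrow> 'a" where \<phi>: "\<And>x y. x \<in> V \<Longrightarrow> y \<in> V \<Longrightarrow> \<phi> (x + y) = \<phi> x + \<phi> y"
    "\<And>x. x \<in> V \<Longrightarrow> \<phi> x = 0 \<Longrightarrow> x = 0"
    using ex_additive_embedding[OF dblv dbla fin(3) V_closed(2) V_closed(1) card_V _ card_a] by auto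
  have \<phi>0: "\<phi> 0 = 0" by (metis \<phi>(1) V_closed(1) add_0_left dbla)
  have \<phi>_sum: "(\<Sum>i\<in>I. \<phi> (f i)) = \<phi> (sum f I) \<and> sum f I \<in> V"
    if "finite I" "\<And>i. i \<in> I \<Longrightarrow> f i \<in> V" for f and I :: "nat set"
    using that by (induction I rule: finite_induct) (auto simp: \<phi>0 \<phi>(1) V_closed)

  obtain b where b: "b ` {..<r} \<subseteq> F r" "\<And>I. I \<subseteq> {..<r} \<Longrightarrow> I \<noteq> {} \<Longrightarrow> sum b I \<noteq> 0"
    using ex_binary_independent[OF dblc fin(1), of r] cards(1) by auto
  obtain x where x: "x ` {..<l} \<subseteq> L" "inj_on x {..<l}"
    using card_le_inj[of "{..<l}" L] fin groups cards(2) by (auto simp: l_def)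
  \<comment> \<open>\<open>c\<close> times the vector of group \<open>j\<close>. Additivity in
    \<open>c\<close> makes a difference of two points of a group again a value of this form under
    \<open>\<phi>\<close>.\<close>
  define U where "U c j = (c, c * x j, c * (x j * \<sigma> (x j)), c * (x j * \<sigma> (x j) * \<sigma> (\<sigma> (x j))))" for c j
  have U_V: "U c j \<in> V" if "c \<in> F r" "j < l" for c j
  proof -
    have "x j \<in> L" using x(1) that by auto
    then show ?thesis using that L_closed K_closed L_\<sigma> norm_K by (simp add: U_def V_def)
  qed
  have U_add: "U (c + d) j = U c j + U d j" for c d j
    by (simp add: U_def distrib_right)
  define B where "B = (\<lambda>i. if i < k + 4 then b (i mod r) else 0)"
  have B_F: "B i \<in> F r" for i
    using b(1) r(1) F_closed(1) by (auto simp: B_def)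
  define \<alpha> where "\<alpha> i = (if i < k + 4 then \<phi> (U (B i) (i div r)) else 0)" for i
  have \<alpha>: "\<alpha> i = \<phi> (U (B i) (G i))" for i
  proof (cases "i < k + 4")
    case False
    then have "U (B i) (G i) = 0" by (simp add: U_def B_def zero_prod_def)
    then show ?thesis using False \<phi>0 by (simp add: \<alpha>_def)
  qed (simp add: \<alpha>_def G_def group_of_def)

  have "(\<Sum>i\<in>I. \<alpha> i + \<alpha> (e (G i))) \<noteq> 0"
    if e: "\<And>j. j < l \<Longrightarrow> e j \<in> local_group k 4 (\<lambda>i. i div r) j"
      and I: "I \<subseteq> {..<N}" "I \<noteq> {}" "card I \<le> 4" "\<And>i. i \<in> I \<Longrightarrow> e (G i) \<noteq> i" for e I
  proof
    assume zero: "(\<Sum>i\<in>I. \<alpha> i + \<alpha> (e (G i))) = 0"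
    have finI: "finite I" using I(1) finite_subset by blast
    have G_e: "G (e j) = j" if "j < l" for j
      using e[OF that] by (auto simp: local_group_def G_def group_of_def)
    define c where "c i = B i + B (e (G i))" for i
    have c_F: "c i \<in> F r" for i using B_F F_closed(2) by (simp add: c_def)
    have I_l: "G i < l" if "i \<in> I" for i using I(1) Gl that by auto
    have "\<alpha> i + \<alpha> (e (G i)) = \<phi> (U (c i) (G i))" if "i \<in> I" for i
      unfolding \<alpha> G_e[OF I_l[OF that]] c_def U_add using U_V[OF B_F I_l[OF that]] by (simp add: \<phi>(1))
    then have "(\<Sum>i\<in>I. \<phi> (U (c i) (G i))) = 0" using zero by simp
    then have "(\<Sum>i\<in>I. U (c i) (G i)) = 0"
      using \<phi>_sum[OF finI, of "\<lambda>i. U (c i) (G i)"] U_V[OF c_F I_l] \<phi>(2) by simp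
    then have comps: "(\<Sum>i\<in>I. c i) = 0" "(\<Sum>i\<in>I. c i * x (G i)) = 0"
      "(\<Sum>i\<in>I. c i * (x (G i) * \<sigma> (x (G i)))) = 0"
      "(\<Sum>i\<in>I. c i * (x (G i) * \<sigma> (x (G i)) * \<sigma> (\<sigma> (x (G i))))) = 0"
      by (simp_all add: U_def sum_prod zero_prod_def)
    \<comment> \<open>Members of \<open>I\<close> in the same group share a vector; collecting their
      coefficients leaves a relation between distinct points.\<close>
    define \<beta> where "\<beta> j = (\<Sum>i | i \<in> I \<and> G i = j. c i)" for j
    have collect: "(\<Sum>j\<in>G ` I. \<beta> j * f j) = (\<Sum>i\<in>I. c i * f (G i))" for f
    proof -
      have "(\<Sum>i\<in>I. c i * f (G i)) = (\<Sum>j\<in>G ` I. \<Sum>i | i \<in> I \<and> G i = j. c i * f (G i))"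
        by (rule sum.image_gen[OF finI])
      also have "\<dots> = (\<Sum>j\<in>G ` I. \<beta> j * f j)"
        by (intro sum.cong refl) (simp add: \<beta>_def sum_distrib_right)
      finally show ?thesis ..
    qed
    show False
    proof (rule E.no_relation_card_le_4[of "G ` I" x \<beta>])
      show "finite (G ` I)" "G ` I \<noteq> {}" using finI I(2) by auto
      show "card (G ` I) \<le> 4" using card_image_le[OF finI, of G] I(3) by simp
      show "inj_on x (G ` I)" using x(2) by (rule inj_on_subset) (use I_l in auto)
      show "\<sigma> (\<beta> j) = \<beta> j" for j
        unfolding \<beta>_def E.sum using \<sigma>_Fr[OF c_F] by simp
      show "\<sigma> (\<sigma> (\<sigma> (x j))) = x j" if "j \<in> G ` I" for j
        by (rule L_order) (use that x(1) I_l in auto)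
      show "(\<Sum>j\<in>G ` I. \<beta> j) = 0" using collect[of "\<lambda>_. 1"] comps(1) by simp
      show "(\<Sum>j\<in>G ` I. \<beta> j * x j) = 0" using collect[of x] comps(2) by simp
      show "(\<Sum>j\<in>G ` I. \<beta> j * (x j * \<sigma> (x j))) = 0"
        using collect[of "\<lambda>j. x j * \<sigma> (x j)"] comps(3) by simp
      show "(\<Sum>j\<in>G ` I. \<beta> j * (x j * \<sigma> (x j) * \<sigma> (\<sigma> (x j)))) = 0"
        using collect[of "\<lambda>j. x j * \<sigma> (x j) * \<sigma> (\<sigma> (x j))"] comps(4) by simp
    next
      fix j assume j: "j \<in> G ` I"
      then have jl: "j < l" using I_l by auto
      have "\<beta> j = (\<Sum>i | i \<in> I \<and> G i = j. B i + B (e j))"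
        unfolding \<beta>_def c_def by (intro sum.cong) auto
      also have "\<dots> \<noteq> 0"
        unfolding B_def
      proof (rule group_difference_sum_nonzero[OF char2c r(1) b(2), where j = j])
        show "finite {i. i \<in> I \<and> G i = j}" using finI by simp
        show "{i. i \<in> I \<and> G i = j} \<noteq> {}" using j by auto
        show "e j \<notin> {i. i \<in> I \<and> G i = j}" using I(4)[of "e j"] by auto
        have grp: "G i = j" if "i \<in> insert (e j) {i. i \<in> I \<and> G i = j}" for i
          using that G_e[OF jl] by auto
        show "i div r = j" if "i \<in> insert (e j) {i. i \<in> I \<and> G i = j}" "i < k + 4" for i
          using grp[OF that(1)] that(2) by (simp add: G_def group_of_def)
        show "i = k + 4 + j" if "i \<in> insert (e j) {i. i \<in> I \<and> G i = j}" "\<not> i < k + 4" for i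
          using grp[OF that(1)] that(2) by (auto simp: G_def group_of_def)
      qed simp_all
      finally show "\<beta> j \<noteq> 0" .
    qed
  qed
  then have "independent_points k r 4 (\<lambda>i. i div r) \<alpha>"
    unfolding independent_points_def l_def[symmetric] N_def[symmetric] G_def[symmetric] by auto
  moreover have "\<forall>i\<ge>k + 4. \<alpha> i = 0" by (simp add: \<alpha>_def)
  ultimately show ?thesis by blast
qed

text \<open>Translation by 1 permutes the field, so comparing the sums of all elements shows that
  the cardinality \<open>2 ^ t\<close> is 0 in the field.\<close>

lemma CHAR_eq_2:
  assumes "card (UNIV :: 'a::{finite,field} set) = 2 ^ t"
  shows "CHAR('a) = 2"
proof -
  have "(\<Sum>x\<in>UNIV. x + 1) = (\<Sum>x\<in>UNIV. x :: 'a)"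
    by (rule sum.reindex_bij_witness[of _ "\<lambda>x. x - 1" "\<lambda>x. x + 1"]) auto
  then have "of_nat (card (UNIV :: 'a set)) = (0 :: 'a)"
    by (simp add: sum.distrib)
  then have "(2 :: 'a) ^ t = 0" using assms by simp
  then have "of_nat 2 = (0 :: 'a)" by simp
  then have "CHAR('a) dvd 2" by (rule of_nat_eq_0_iff_char_dvd[THEN iffD1])
  then show ?thesis using CHAR_not_1'[where 'a = 'a]
    by (metis One_nat_def prime_nat_iff two_is_prime_nat)
qed

theorem theorem18:
  fixes k r m t :: nat
  assumes "0 < k" and "0 < r" and "r dvd (k + 4)"
    and "m = (LEAST m::nat. 1 \<le> m \<and> 3 dvd (m - 1) \<and> (k + 4) div r \<le> 2 ^ (r * (m - 1)))"
    and "t = r * (2 * m + (m - 1) div 3)"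
    and "card (UNIV :: ('a::{finite,field}) set) = 2 ^ t"
  shows "\<exists>(H :: nat \<Rightarrow> nat \<Rightarrow> 'a) g.
           valid_grouping k r 4 g \<and> maximally_recoverable k r 4 H g"
proof -
  let ?P = "\<lambda>m::nat. 1 \<le> m \<and> 3 dvd (m - 1) \<and> (k + 4) div r \<le> 2 ^ (r * (m - 1))"
  \<comment> \<open>Any admissible value shows that the minimum exists; this one works because
    \<open>n < 2 ^ n\<close>.\<close>
  have "?P (3 * (k + 4) + 1)"
  proof -
    have "(k + 4) div r \<le> k + 4" by (rule div_le_dividend)
    also have "\<dots> \<le> r * (3 * (k + 4))" using assms(2) by (cases r) auto
    also have "\<dots> \<le> 2 ^ (r * (3 * (k + 4)))" by (rule less_imp_le[OF less_exp])
    finally show ?thesis unfolding add_diff_cancel_right' by simp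
  qed
  then have m: "?P m" unfolding assms(4) by (rule LeastI)
  then obtain s where s: "m = 3 * s + 1" by (metis dvdE le_add_diff_inverse2)
  have char2: "CHAR('a) = 2" by (rule CHAR_eq_2[OF assms(6)])
  \<comment> \<open>With \<open>m = 3 * s + 1\<close>, the exponent \<open>t\<close> equals
    \<open>r * (2 + 7 * s)\<close>.\<close>
  have "r * (1 + 7 * s) \<le> t" unfolding assms(5) s by (intro mult_left_mono) simp_all
  then have "2 ^ (r * (1 + 7 * s)) \<le> card (UNIV :: 'a set)"
    unfolding assms(6) by (intro power_increasing) simp_all
  moreover have "(k + 4) div r \<le> 2 ^ (r * (3 * s))" using m by (simp add: s)
  ultimately obtain \<alpha> :: "nat \<Rightarrow> 'a" where \<alpha>: "independent_points k r 4 (\<lambda>i. i div r) \<alpha>"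
    "\<And>i. k + 4 \<le> i \<Longrightarrow> \<alpha> i = 0"
    using ex_independent_points[OF char2 assms(2,3)] by blast
  have g: "valid_grouping k r 4 (\<lambda>i. i div r)" by (rule valid_grouping_div[OF assms(2,3)])
  have "\<exists>H :: nat \<Rightarrow> nat \<Rightarrow> 'a. maximally_recoverable k r 4 H (\<lambda>i. i div r)"
    using independent_points_maximally_recoverable[OF char2 assms(1) g \<alpha>] .
  then show ?thesis using g by blast
qed

end
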